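(* For any tree $T$, $\Gamma(T)\le z(T)^2$.
   Context: A proper coloring with colors $1,\dots,k$ is a Grundy coloring if for any $i<j$, every vertex of color $j$ has a neighbor of color $i$; $\Gamma(T)$ is the maximum number of colors in a Grundy coloring of $T$. A vertex of color $i$ is color-dominating if it has a neighbor of every other color $j\neq i$ used. A $z$-coloring is a proper coloring using $k$ colors which is a Grundy coloring, in which every color class contains a color-dominating vertex, and which contains color-dominating vertices $u_1,\dots,u_k$ with $u_j$ of color $j$ and $u_k$ adjacent to $u_j$ for every $j\neq k$. $z(T)$ is the maximum number of colors in a $z$-coloring of $T$. *)

theory Defs
  imports "Graph_Theory.Graph_Theory"
begin

text \<open>
  A finite simple graph is a \<^locale>\<open>pair_graph\<close>: a finite loopfree digraph without parallel
  arcs whose arc relation is symmetric, so each undirected edge \<open>uv\<close> is present as the two arcs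
  \<open>(u,v)\<close> and \<open>(v,u)\<close>. Such a graph counts \<open>u,v,u\<close> as a directed cycle, so the
  library predicate \<^const>\<open>tree\<close> is too strong here; only cycles of length at least 3 are
  excluded. A tree is nonempty because \<^const>\<open>connected\<close> demands it.
\<close>
definition undirected_tree :: "'a pair_pre_digraph \<Rightarrow> bool" where
  "undirected_tree T \<longleftrightarrow>
     pair_graph T \<and> connected (with_proj T) \<and>
     \<not> (\<exists>p. pre_digraph.cycle (with_proj T) p \<and> length p \<ge> 3)"

text \<open>All of the colors \<open>1, \<dots>, k\<close> occur; values of \<open>c\<close> outside the vertex set are irrelevant.\<close>
definition proper_coloring :: "'a pair_pre_digraph \<Rightarrow> nat \<Rightarrow> ('a \<Rightarrow> nat) \<Rightarrow> bool" where
  "proper_coloring G k c \<longleftrightarrow>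
     c ` pverts G = {1..k} \<and> (\<forall>(u, v) \<in> parcs G. c u \<noteq> c v)"

definition grundy_coloring :: "'a pair_pre_digraph \<Rightarrow> nat \<Rightarrow> ('a \<Rightarrow> nat) \<Rightarrow> bool" where
  "grundy_coloring G k c \<longleftrightarrow>
     proper_coloring G k c \<and>
     (\<forall>i\<in>{1..k}. \<forall>j\<in>{1..k}. i < j \<longrightarrow>
        (\<forall>v\<in>pverts G. c v = j \<longrightarrow> (\<exists>w. (v, w) \<in> parcs G \<and> c w = i)))"

definition color_dominating ::
  "'a pair_pre_digraph \<Rightarrow> nat \<Rightarrow> ('a \<Rightarrow> nat) \<Rightarrow> 'a \<Rightarrow> bool" where
  "color_dominating G k c v \<longleftrightarrow>
     v \<in> pverts G \<and>
     (\<forall>j\<in>{1..k}. j \<noteq> c v \<longrightarrow> (\<exists>w. (v, w) \<in> parcs G \<and> c w = j))"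

definition z_coloring :: "'a pair_pre_digraph \<Rightarrow> nat \<Rightarrow> ('a \<Rightarrow> nat) \<Rightarrow> bool" where
  "z_coloring G k c \<longleftrightarrow>
     grundy_coloring G k c \<and>
     (\<forall>j\<in>{1..k}. \<exists>v. c v = j \<and> color_dominating G k c v) \<and>
     (\<exists>u. (\<forall>j\<in>{1..k}. c (u j) = j \<and> color_dominating G k c (u j)) \<and>
          (\<forall>j\<in>{1..k}. j \<noteq> k \<longrightarrow> (u k, u j) \<in> parcs G))"

definition grundy_number :: "'a pair_pre_digraph \<Rightarrow> nat" where
  "grundy_number G = Max {k. \<exists>c. grundy_coloring G k c}"

definition z_number :: "'a pair_pre_digraph \<Rightarrow> nat" where
  "z_number G = Max {k. \<exists>c. z_coloring G k c}"

text \<open>The two maxima range over finite sets.\<close>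

lemma finite_grundy_coloring_sizes:
  assumes "finite (pverts G)"
  shows "finite {k. \<exists>c. grundy_coloring G k c}"
proof (rule finite_subset)
  show "{k. \<exists>c. grundy_coloring G k c} \<subseteq> {..card (pverts G)}"
  proof
    fix k assume "k \<in> {k. \<exists>c. grundy_coloring G k c}"
    then obtain c where "c ` pverts G = {1..k}"
      unfolding grundy_coloring_def proper_coloring_def by blast
    then have "k = card (c ` pverts G)" by simp
    then show "k \<in> {..card (pverts G)}"
      using card_image_le[OF assms, of c] by simp
  qed
qed simp

lemma finite_z_coloring_sizes:
  assumes "finite (pverts G)"
  shows "finite {k. \<exists>c. z_coloring G k c}"
proof (rule finite_subset)
  show "{k. \<exists>c. z_coloring G k c} \<subseteq> {k. \<exists>c. grundy_coloring G k c}"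
    unfolding z_coloring_def by blast
qed (rule finite_grundy_coloring_sizes[OF assms])

end

theory Submission
  imports Defs
begin

text \<open>
  Put \<open>k = \<Gamma>(T)\<close> and \<open>s = k div 2 + 1\<close>. We show \<open>s \<le> z(T)\<close>, hence
  \<open>\<Gamma>(T) \<le> 2 * z(T) - 1 \<le> z(T)\<^sup>2\<close>. A vertex \<open>r\<close> of color \<open>k\<close> has a neighbor \<open>u\<^sub>j\<close> of color
  \<open>2 * s - 2 - j\<close> for every \<open>1 \<le> j < s\<close>. This color is at least \<open>s\<close>, or equal to \<open>j\<close> when \<open>j = s - 1\<close>,
  so \<open>u\<^sub>j\<close> has neighbors of all colors \<open>i < s\<close> other than \<open>j\<close>. Recolor \<open>r\<close> with \<open>s\<close> and each \<open>u\<^sub>j\<close> with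
  \<open>j\<close>, and keep besides them only what can be reached along paths of decreasing color from the neighbors of
  \<open>u\<^sub>j\<close> with colors in \<open>{1..s-1} - {j}\<close>. In a tree no unwanted adjacencies occur, so this is a
  \<open>z\<close>-coloring of a subtree with \<open>s\<close> colors. It extends to \<open>T\<close> leaf by leaf: a new vertex is adjacent
  to just one old vertex, so color 1 or color 2 is always suitable.
\<close>

section \<open>Induced subgraphs and connected vertex sets\<close>

definition induced :: "'a pair_pre_digraph \<Rightarrow> 'a set \<Rightarrow> 'a pair_pre_digraph" where
  "induced G S = \<lparr>pverts = S, parcs = Restr (parcs G) S\<rparr>"

lemma induced_simps [simp]:
  "pverts (induced G S) = S"
  "parcs (induced G S) = Restr (parcs G) S"
  by (simp_all add: induced_def)

text \<open>Directed reachability is enough, since the arcs of the graphs considered are symmetric.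
  The empty set qualifies, so nonemptiness has to be requested separately.\<close>

definition connected_in :: "'a pair_pre_digraph \<Rightarrow> 'a set \<Rightarrow> bool" where
  "connected_in G S \<longleftrightarrow>
     S \<subseteq> pverts G \<and> (\<forall>x\<in>S. \<forall>y\<in>S. (x, y) \<in> (Restr (parcs G) S)\<^sup>*)"

lemma connected_in_subset: "connected_in G S \<Longrightarrow> S \<subseteq> pverts G"
  by (simp add: connected_in_def)

lemma connected_inD:
  "connected_in G S \<Longrightarrow> x \<in> S \<Longrightarrow> y \<in> S \<Longrightarrow> (x, y) \<in> (Restr (parcs G) S)\<^sup>*"
  by (simp add: connected_in_def)

lemma connected_in_singleton: "v \<in> pverts G \<Longrightarrow> connected_in G {v}"
  by (simp add: connected_in_def)

section \<open>Connectedness and acyclicity in trees\<close>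

locale utree =
  fixes T :: "'a pair_pre_digraph"
  assumes utree: "undirected_tree T"

sublocale utree \<subseteq> pair_graph T
  using utree by (simp add: undirected_tree_def)

context utree
begin

lemma sym_restr: "sym (Restr (parcs T) S)"
  by (auto intro!: symI arcs_symmetric)

lemma connected_inI:
  assumes "S \<subseteq> pverts T" "r \<in> S" "\<And>x. x \<in> S \<Longrightarrow> (r, x) \<in> (Restr (parcs T) S)\<^sup>*"
  shows "connected_in T S"
  unfolding connected_in_def
proof (intro conjI ballI)
  fix x y assume "x \<in> S" "y \<in> S"
  with assms(3) have "(r, x) \<in> (Restr (parcs T) S)\<^sup>*" "(r, y) \<in> (Restr (parcs T) S)\<^sup>*" by auto
  then show "(x, y) \<in> (Restr (parcs T) S)\<^sup>*"
    using symD[OF sym_rtrancl[OF sym_restr]] rtrancl_trans by fast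
qed fact

text \<open>Overlapping and adjacent sets are treated together, because the branches built later
  must be shown neither to meet nor to touch.\<close>

lemma connected_in_Un:
  assumes A: "connected_in T A" and B: "connected_in T B"
    and ab: "a \<in> A" "b \<in> B" "a = b \<or> (a, b) \<in> parcs T"
  shows "connected_in T (A \<union> B)"
proof (rule connected_inI)
  show "A \<union> B \<subseteq> pverts T" using A B by (simp add: connected_in_def)
  show "a \<in> A \<union> B" using ab by simp
  have mono: "(Restr (parcs T) C)\<^sup>* \<subseteq> (Restr (parcs T) (A \<union> B))\<^sup>*" if "C \<subseteq> A \<union> B" for C
    using that by (intro rtrancl_mono) auto
  have a_A: "(a, x) \<in> (Restr (parcs T) (A \<union> B))\<^sup>*" if "x \<in> A" for x
    by (rule subsetD[OF mono connected_inD[OF A \<open>a \<in> A\<close> that]]) simp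
  have b_B: "(b, x) \<in> (Restr (parcs T) (A \<union> B))\<^sup>*" if "x \<in> B" for x
    by (rule subsetD[OF mono connected_inD[OF B \<open>b \<in> B\<close> that]]) simp
  have a_b: "(a, b) \<in> (Restr (parcs T) (A \<union> B))\<^sup>*" using ab by auto
  fix x assume "x \<in> A \<union> B"
  then show "(a, x) \<in> (Restr (parcs T) (A \<union> B))\<^sup>*"
    using a_A rtrancl_trans[OF a_b b_B] by blast
qed

lemma connected_in_insert:
  assumes "connected_in T A" "a \<in> A" "(a, v) \<in> parcs T"
  shows "connected_in T (insert v A)"
  using connected_in_Un[OF assms(1) connected_in_singleton[of v T] assms(2), of v] assms(3)
  by (auto dest: in_arcsD2)

lemma pawalk_verts_snoc:
  "pcas x p y \<Longrightarrow> pawalk_verts x (p @ [(y, v)]) = pawalk_verts x p @ [v]"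
  by (induction p arbitrary: x) auto

lemma pcas_in_set:
  "pcas x p y \<Longrightarrow> set p \<subseteq> S \<times> S \<Longrightarrow> x \<in> S \<Longrightarrow> set (pawalk_verts x p) \<subseteq> S"
proof (induction p arbitrary: x)
  case (Cons e p)
  have "set (pawalk_verts (snd e) p) \<subseteq> S"
    by (rule Cons.IH) (use Cons.prems in auto)
  with Cons.prems show ?case by auto
qed simp

text \<open>Two distinct neighbors of \<open>v\<close> in \<open>S\<close> would be joined by a path
  inside \<open>S\<close>, and \<open>v\<close> would close it to a cycle. This is the only place
  where acyclicity enters.\<close>

lemma unique_neighbor:
  assumes S: "connected_in T S" and v: "v \<notin> S"
    and x: "x \<in> S" "(v, x) \<in> parcs T" and y: "y \<in> S" "(v, y) \<in> parcs T"
  shows "x = y"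
proof (rule ccontr)
  assume "x \<noteq> y"
  have "(x, y) \<in> (Restr (parcs T) S)\<^sup>*" using connected_inD[OF S x(1) y(1)] .
  then have "\<exists>p. awalk x p y \<and> set p \<subseteq> Restr (parcs T) S"
  proof (induction rule: converse_rtrancl_induct)
    case base
    have "awalk y [] y" using S y(1) by (auto simp: awalk_Nil_iff connected_in_def)
    then show ?case by fastforce
  next
    case (step a b)
    then obtain p where "awalk b p y" "set p \<subseteq> Restr (parcs T) S" by auto
    with step(1) have "awalk a ((a, b) # p) y \<and> set ((a, b) # p) \<subseteq> Restr (parcs T) S"
      by (auto simp: awalk_Cons_iff)
    then show ?case by blast
  qed
  then obtain q where "awalk x q y" "set q \<subseteq> Restr (parcs T) S" by auto
  then obtain p where p: "apath x p y" "set p \<subseteq> Restr (parcs T) S"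
    using apath_awalk_to_apath awalk_to_apath_subset by (meson subset_trans)
  have aw: "awalk x p y" and dist: "distinct (pawalk_verts x p)"
    using p(1) by (auto simp: apath_def)
  then have cas: "pcas x p y" by (simp add: awalk_def)
  have "p \<noteq> []" using cas \<open>x \<noteq> y\<close> by auto
  let ?c = "(v, x) # p @ [(y, v)]"
  have yv: "(y, v) \<in> parcs T" using y(2) by (rule arcs_symmetric)
  then have "awalk y [(y, v)] v" using in_arcsD2 by (auto simp: awalk_simps)
  with aw have "awalk x (p @ [(y, v)]) v" by (rule awalk_appendI)
  with x(2) have "awalk v ?c v" by (simp add: awalk_Cons_iff del: awalk_append_iff)
  \<comment> \<open>The path stays in \<open>S\<close>, so it avoids \<open>v\<close>. The library
    predicate \<open>cycle\<close> asks for distinct vertices after the first one only, hence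
    \<open>tl\<close>.\<close>
  moreover have "v \<notin> set (pawalk_verts x p)"
    using pcas_in_set[OF cas _ x(1)] p(2) v by blast
  then have "distinct (tl (pawalk_verts v ?c))"
    using dist by (simp add: pawalk_verts_snoc[OF cas])
  ultimately have "cycle ?c" unfolding cycle_def by blast
  moreover have "length ?c \<ge> 3" using \<open>p \<noteq> []\<close> by (cases p) auto
  ultimately show False using utree unfolding undirected_tree_def by blast
qed

lemma leaving_arc:
  assumes "S \<subset> pverts T" "S \<noteq> {}"
  obtains p v where "p \<in> S" "v \<in> pverts T - S" "(p, v) \<in> parcs T"
proof -
  obtain x y where x: "x \<in> S" and y: "y \<in> pverts T" "y \<notin> S" using assms by blast
  \<comment> \<open>\<open>connected\<close> speaks about the symmetric closure. As \<open>T\<close>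
    is already symmetric, reachability in \<open>T\<close> itself follows, and a walk from
    \<open>x\<close> to \<open>y\<close> must leave \<open>S\<close> somewhere.\<close>
  have "strongly_connected (mk_symmetric (with_proj T))"
    using utree by (simp add: undirected_tree_def connected_def)
  then have "x \<rightarrow>\<^sup>*\<^bsub>with_proj (mk_symmetric (with_proj T))\<^esub> y"
    using x y assms by (auto simp: strongly_connected_def)
  then have "x \<rightarrow>\<^sup>*\<^bsub>with_proj T\<^esub> y" using reachable_mk_symmetric_eq sym_arcs by blast
  then have "(x, y) \<in> (parcs T)\<^sup>*" by (simp add: reachable_def rtrancl_on_rtranclI)
  then have "y \<in> S \<or> (\<exists>p v. p \<in> S \<and> v \<in> pverts T - S \<and> (p, v) \<in> parcs T)"
    by (induction rule: rtrancl_induct) (use x in_arcsD2 in blast)+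
  with y that show thesis by blast
qed

section \<open>Extending a z-coloring from a subtree to the whole tree\<close>

text \<open>The only old neighbor of \<open>v\<close> is \<open>p\<close>. Color 1 needs no smaller
  neighbor, and color 2 is chosen only when \<open>p\<close> has color 1 and so supplies it. Old
  vertices keep their colors and neighbors, so they stay dominating.\<close>

lemma z_coloring_extend_leaf:
  assumes S: "connected_in T S" and z: "z_coloring (induced T S) k c" and k: "k \<ge> 2"
    and p: "p \<in> S" and v: "v \<notin> S" and pv: "(p, v) \<in> parcs T"
  shows "z_coloring (induced T (insert v S)) k (c(v := if c p = 1 then 2 else 1))"
proof -
  let ?H = "induced T S" and ?G = "induced T (insert v S)"
  define c' where "c' = c(v := if c p = 1 then 2 else 1)"
  have c'v: "c' v = (if c p = 1 then 2 else 1)" by (simp add: c'_def)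
  have g: "grundy_coloring ?H k c" using z by (simp add: z_coloring_def)
  then have im: "c ` S = {1..k}" by (simp add: grundy_coloring_def proper_coloring_def)
  have old: "c' x = c x" if "x \<in> S" for x using that v by (auto simp: c'_def)
  have sub: "parcs ?H \<subseteq> parcs ?G" by auto
  have vp: "(v, p) \<in> parcs T" using pv by (rule arcs_symmetric)
  have only: "x = p" if "x \<in> S" "(v, x) \<in> parcs T \<or> (x, v) \<in> parcs T" for x
    using unique_neighbor[OF S v that(1) _ p vp] that(2) arcs_symmetric by blast
  have new: "c' v \<in> {1..k}" "c' v \<noteq> c p" using k c'v by auto
  have "c' ` insert v S = insert (c' v) (c ` S)" using old v by auto
  with im new have im': "c' ` insert v S = {1..k}" by auto
  have "c' a \<noteq> c' b" if ab: "(a, b) \<in> parcs ?G" for a b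
  proof -
    consider "a \<in> S" "b \<in> S" | "a = v" "b \<in> S" | "a \<in> S" "b = v" | "a = v" "b = v"
      using ab by auto
    then show ?thesis
    proof cases
      case 1
      then have "(a, b) \<in> parcs ?H" using ab by auto
      then have "c a \<noteq> c b" using g unfolding grundy_coloring_def proper_coloring_def by blast
      with 1 old show ?thesis by simp
    next
      case 2
      then show ?thesis using only[of b] ab new old v by auto
    next
      case 3
      then show ?thesis using only[of a] ab new old v by auto
    next
      case 4
      then show ?thesis using ab no_loops' by auto
    qed
  qed
  then have proper: "proper_coloring ?G k c'"
    using im' unfolding proper_coloring_def induced_simps by blast
  have lift: "\<exists>y. (x, y) \<in> parcs ?G \<and> c' y = i" if ex: "\<exists>y. (x, y) \<in> parcs ?H \<and> c y = i" for x i
  proof -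
    obtain y where "(x, y) \<in> parcs ?H" "c y = i" using ex by blast
    then have "(x, y) \<in> parcs ?G \<and> c' y = i" using old sub by auto
    then show ?thesis by blast
  qed
  have "\<exists>w. (x, w) \<in> parcs ?G \<and> c' w = i"
    if i: "i \<in> {1..k}" "i < c' x" and x: "x \<in> pverts ?G" for i x
  proof (cases "x = v")
    case True
    \<comment> \<open>A color below that of \<open>v\<close> exists only if \<open>v\<close>
      received color 2.\<close>
    with i have "c p = 1" "i = 1" using c'v by (auto split: if_splits)
    then have "(x, p) \<in> parcs ?G \<and> c' p = i" using True vp p old by auto
    then show ?thesis by blast
  next
    case False
    then have "x \<in> S" using x by simp
    moreover from this have "c x \<in> {1..k}" using im by blast
    ultimately have "\<exists>w. (x, w) \<in> parcs ?H \<and> c w = i"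
      using g i old[of x] unfolding grundy_coloring_def by (metis induced_simps(1))
    then show ?thesis by (rule lift)
  qed
  then have grundy: "grundy_coloring ?G k c'"
    using proper unfolding grundy_coloring_def by blast
  have cd: "color_dominating ?G k c' x" if "color_dominating ?H k c x" for x
  proof -
    have x: "x \<in> S" using that by (simp add: color_dominating_def)
    have "\<exists>w. (x, w) \<in> parcs ?G \<and> c' w = j" if "j \<in> {1..k}" "j \<noteq> c' x" for j
      by (rule lift) (use \<open>color_dominating ?H k c x\<close> that old[OF x] color_dominating_def in metis)
    then show ?thesis using x by (simp add: color_dominating_def)
  qed
  obtain u where u: "\<And>j. j \<in> {1..k} \<Longrightarrow> c (u j) = j \<and> color_dominating ?H k c (u j)"
      and uk: "\<And>j. j \<in> {1..k} \<Longrightarrow> j \<noteq> k \<Longrightarrow> (u k, u j) \<in> parcs ?H"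
    using z unfolding z_coloring_def by blast
  have u': "c' (u j) = j \<and> color_dominating ?G k c' (u j)" if "j \<in> {1..k}" for j
  proof -
    have "u j \<in> S" using u[OF that] by (simp add: color_dominating_def)
    then show ?thesis using u[OF that] cd old by metis
  qed
  show ?thesis
    unfolding z_coloring_def c'_def[symmetric] using grundy u' uk sub by blast
qed

text \<open>Induction on the number of vertices outside \<open>S\<close>; as \<open>T\<close> is
  connected, some outside vertex is adjacent to \<open>S\<close>.\<close>

lemma z_coloring_extend:
  assumes "connected_in T S" "S \<noteq> {}" "z_coloring (induced T S) k c" "k \<ge> 2"
  shows "\<exists>c. z_coloring T k c"
  using assms
proof (induction "card (pverts T - S)" arbitrary: S c rule: less_induct)
  case less
  have sub: "S \<subseteq> pverts T" using less.prems(1) by (rule connected_in_subset)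
  show ?case
  proof (cases "S = pverts T")
    case True
    have "induced T S = T"
      using True by (auto simp: induced_def intro!: pair_pre_digraph.equality dest: wellformed')
    then show ?thesis using less.prems by auto
  next
    case False
    then obtain p v where pv: "p \<in> S" "v \<in> pverts T - S" "(p, v) \<in> parcs T"
      using leaving_arc[of S] sub less.prems(2) by blast
    then have v: "v \<notin> S" by simp
    show ?thesis
    proof (rule less.hyps)
      show "card (pverts T - insert v S) < card (pverts T - S)"
        using pv pair_finite_verts by (intro psubset_card_mono) auto
      show "connected_in T (insert v S)"
        using connected_in_insert[OF less.prems(1) pv(1,3)] .
    qed (use z_coloring_extend_leaf[OF less.prems(1,3,4) pv(1) v pv(3)] less.prems(4) in auto)
  qed
qed

section \<open>Turning a Grundy coloring into a z-coloring\<close>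

text \<open>All intermediate vertices of a walk along \<open>R\<close> from \<open>w\<close> are
  reachable too, so the walk stays in the set. The lemma is applied to the relation of
  color-decreasing arcs.\<close>

lemma connected_in_reach:
  assumes "R \<subseteq> parcs T" "w \<in> pverts T"
  shows "connected_in T (R\<^sup>* `` {w})"
proof -
  have reach: "x \<in> pverts T \<and> (w, x) \<in> (Restr (parcs T) (R\<^sup>* `` {w}))\<^sup>*" if "(w, x) \<in> R\<^sup>*" for x
    using that
  proof (induction rule: rtrancl_induct)
    case base
    then show ?case using assms by simp
  next
    case (step y z)
    then have "(y, z) \<in> Restr (parcs T) (R\<^sup>* `` {w})"
      using assms by (auto intro: rtrancl_into_rtrancl)
    with step.IH show ?case by (auto dest: in_arcsD2 intro: rtrancl_into_rtrancl)
  qed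
  show ?thesis
    by (rule connected_inI[where r = w]) (use reach in auto)
qed

lemma z_coloring_of_grundy_coloring:
  assumes g: "grundy_coloring T k c" and k: "k \<ge> 2"
  shows "\<exists>c. z_coloring T (k div 2 + 1) c"
proof -
  define s where "s = k div 2 + 1"
  \<comment> \<open>\<open>2 * s - 2\<close> is \<open>k\<close> or \<open>k - 1\<close>, so for
    \<open>1 \<le> j < s\<close> the colors \<open>2 * s - 2 - j\<close> are distinct, below
    \<open>k\<close> and at least \<open>s - 1\<close>.\<close>
  have s: "s \<ge> 2" "2 * s - 2 \<le> k" "s \<le> k" using k by (auto simp: s_def)
  have im: "c ` pverts T = {1..k}"
    using g by (simp add: grundy_coloring_def proper_coloring_def)
  then have range: "c x \<in> {1..k}" if "x \<in> pverts T" for x using that by blast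
  have proper: "c x \<noteq> c y" if "(x, y) \<in> parcs T" for x y
    using g that unfolding grundy_coloring_def proper_coloring_def by blast
  have down: "\<exists>w. (x, w) \<in> parcs T \<and> c w = i" if "x \<in> pverts T" "1 \<le> i" "i < c x" for x i
    proof -
    have "i \<in> {1..k}" using that range[of x] by auto
    with g that range[of x] show ?thesis unfolding grundy_coloring_def by blast
  qed
  define J where "J = {1..<s}"
  have "k \<in> c ` pverts T" using im k by simp
  then obtain r where r: "r \<in> pverts T" "c r = k" by blast
  have "\<exists>v. (r, v) \<in> parcs T \<and> c v = 2 * s - 2 - j" if "j \<in> J" for j
    by (rule down) (use that r s in \<open>auto simp: J_def\<close>)
  then obtain u where u: "\<And>j. j \<in> J \<Longrightarrow> (r, u j) \<in> parcs T"
      and cu: "\<And>j. j \<in> J \<Longrightarrow> c (u j) = 2 * s - 2 - j"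
    by metis
  have uV: "u j \<in> pverts T" if "j \<in> J" for j using u[OF that] by (rule in_arcsD2)
  have u_inj: "j = j'" if "j \<in> J" "j' \<in> J" "u j = u j'" for j j'
    using cu[OF that(1)] cu[OF that(2)] that by (auto simp: J_def)
  \<comment> \<open>\<open>R\<close> follows strictly decreasing colors. \<open>W j\<close> omits
    color \<open>j\<close> because \<open>u j\<close> will receive it; \<open>B j\<close> is the
    branch below \<open>u j\<close>, and \<open>A j\<close> adds \<open>u j\<close> itself.\<close>
  define R where "R = {(x, y) \<in> parcs T. c y < c x}"
  define W where "W j = {w. (u j, w) \<in> parcs T \<and> c w \<in> J - {j}}" for j
  define B where "B j = R\<^sup>* `` W j" for j
  define A where "A j = insert (u j) (B j)" for j
  have R: "R \<subseteq> parcs T" by (auto simp: R_def)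
  \<comment> \<open>A tie \<open>c w = c (u j)\<close> could occur only at color
    \<open>s - 1\<close> with \<open>j = s - 1\<close>, and there \<open>W j\<close> leaves out that
    color.\<close>
  have W: "w \<in> pverts T" "c w < c (u j)" "c w < s" if "j \<in> J" "w \<in> W j" for j w
    using that cu[of j] by (auto simp: W_def J_def dest: in_arcsD2)
  have desc: "c d \<le> c w" if "(w, d) \<in> R\<^sup>*" for w d
    using that by (induction rule: rtrancl_induct) (auto simp: R_def)
  have connD: "connected_in T (R\<^sup>* `` {w})" if "j \<in> J" "w \<in> W j" for j w
    using connected_in_reach[OF R] W that by blast
  have B: "d \<in> pverts T" "c d < c (u j)" "c d < s" "c d \<in> {1..k}" if j: "j \<in> J" and d: "d \<in> B j" for j d
  proof -
    obtain w where w: "w \<in> W j" "(w, d) \<in> R\<^sup>*" using d by (auto simp: B_def)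
    then show "d \<in> pverts T" using connected_in_subset[OF connD[OF j w(1)]] by auto
    then show "c d \<in> {1..k}" by (rule range)
    show "c d < c (u j)" "c d < s" using W[OF j w(1)] desc[OF w(2)] by auto
  qed
  have connA: "connected_in T (A j)" if j: "j \<in> J" for j
  proof (rule connected_inI)
    show "A j \<subseteq> pverts T" using B[OF j] uV[OF j] by (auto simp: A_def)
    show "u j \<in> A j" by (simp add: A_def)
    fix x assume "x \<in> A j"
    then consider "x = u j" | w where "w \<in> W j" "(w, x) \<in> R\<^sup>*" by (auto simp: A_def B_def)
    then show "(u j, x) \<in> (Restr (parcs T) (A j))\<^sup>*"
    proof cases
      case 2
      have "(w, x) \<in> (Restr (parcs T) (R\<^sup>* `` {w}))\<^sup>*"
        using connected_inD[OF connD[OF j 2(1)]] 2(2) by auto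
      also have "\<dots> \<subseteq> (Restr (parcs T) (A j))\<^sup>*"
        using 2(1) by (intro rtrancl_mono) (auto simp: A_def B_def)
      finally have "(w, x) \<in> (Restr (parcs T) (A j))\<^sup>*" .
      moreover have "(u j, w) \<in> Restr (parcs T) (A j)"
        using 2(1) by (auto simp: A_def B_def W_def)
      ultimately show ?thesis by (rule converse_rtrancl_into_rtrancl[rotated])
    qed simp
  qed
  have ck: "c (u j) < k" if "j \<in> J" for j
    using cu[OF that] that s by (auto simp: J_def)
  \<comment> \<open>Every color in \<open>A j\<close> is below \<open>k\<close>, the color of
    \<open>r\<close>.\<close>
  have rA: "r \<notin> A j" if j: "j \<in> J" for j
    using ck[OF j] B(2)[OF j, of r] r by (auto simp: A_def)
  have r_nbr: "x = u j" if "j \<in> J" "x \<in> A j" "(r, x) \<in> parcs T" for j x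
    using unique_neighbor[OF connA rA, of j x "u j"] that u by (auto simp: A_def)
  \<comment> \<open>If two of these sets met or touched, their union would be connected, would miss
    \<open>r\<close> and would contain the neighbors \<open>u j\<close> and \<open>u j'\<close> of
    \<open>r\<close>; \<open>unique_neighbor\<close> makes these equal.\<close>
  have separate: "j = j'" if j: "j \<in> J" "j' \<in> J" and xy: "x \<in> A j" "y \<in> A j'" "x = y \<or> (x, y) \<in> parcs T"
    for j j' x y
  proof -
    have "connected_in T (A j \<union> A j')" using connected_in_Un[OF connA connA] j xy by blast
    then have "u j = u j'"
      by (rule unique_neighbor) (use j rA u in \<open>auto simp: A_def\<close>)
    then show ?thesis using j u_inj by blast
  qed
  \<comment> \<open>The vertices reached from \<open>w\<close> form a connected set without
    \<open>u j\<close>, so \<open>w\<close> is the only neighbor of \<open>u j\<close> among them,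
    and its color is not \<open>j\<close>. Hence giving \<open>u j\<close> color \<open>j\<close>
    causes no conflict inside \<open>A j\<close>.\<close>
  have u_nbr: "c x \<noteq> j" if j: "j \<in> J" and x: "x \<in> B j" "(u j, x) \<in> parcs T" for j x
  proof -
    obtain w where w: "w \<in> W j" "(w, x) \<in> R\<^sup>*" using x by (auto simp: B_def)
    have "u j \<notin> R\<^sup>* `` {w}" using desc[of w "u j"] W(2)[OF j w(1)] by auto
    then have "x = w"
      using unique_neighbor[OF connD[OF j w(1)]] w x(2) by (auto simp: W_def)
    then show ?thesis using w by (auto simp: W_def)
  qed
  define H where "H = insert r (\<Union>j\<in>J. A j)"
  \<comment> \<open>The old color of \<open>u j\<close> is \<open>2 * s - 2 - j\<close>, so the middle case gives \<open>u j\<close> the color \<open>j\<close>.\<close>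
  define c' where "c' x = (if x = r then s else if x \<in> u ` J then 2 * s - 2 - c x else c x)" for x
  have c'r: "c' r = s" by (simp add: c'_def)
  have c'u: "c' (u j) = j" if "j \<in> J" for j
    using cu[OF that] that rA[OF that] s by (auto simp: c'_def J_def A_def)
  \<comment> \<open>No vertex of a branch is recolored: \<open>separate\<close> excludes
    \<open>u j'\<close> for other indices, and \<open>u j\<close> has a larger color than all of
    \<open>B j\<close>.\<close>
  have c'B: "c' d = c d" if j: "j \<in> J" and d: "d \<in> B j" for j d
  proof -
    have "d \<noteq> u j'" if "j' \<in> J" for j'
      using separate[OF j that, of d "u j'"] B(2)[OF j d] d by (auto simp: A_def)
    then show ?thesis using rA[OF j] d by (auto simp: c'_def A_def)
  qed
  have H_cases: "x = r \<or> (\<exists>j\<in>J. x = u j) \<or> (\<exists>j\<in>J. x \<in> B j)" if "x \<in> H" for x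
    using that by (auto simp: H_def A_def)
  have inH: "r \<in> H" "\<And>j. j \<in> J \<Longrightarrow> u j \<in> H" "\<And>j d. j \<in> J \<Longrightarrow> d \<in> B j \<Longrightarrow> d \<in> H"
    by (auto simp: H_def A_def)
  let ?G = "induced T H"
  have connH: "connected_in T H"
  proof (rule connected_inI)
    show "H \<subseteq> pverts T" using r connected_in_subset[OF connA] by (auto simp: H_def)
    show "r \<in> H" by fact
    fix x assume "x \<in> H"
    then consider "x = r" | j where "j \<in> J" "x \<in> A j" by (auto simp: H_def)
    then show "(r, x) \<in> (Restr (parcs T) H)\<^sup>*"
    proof cases
      case 2
      have "(u j, x) \<in> (Restr (parcs T) (A j))\<^sup>*"
        using connected_inD[OF connA[OF 2(1)]] 2 by (auto simp: A_def)
      also have "\<dots> \<subseteq> (Restr (parcs T) H)\<^sup>*"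
        using 2 by (intro rtrancl_mono) (auto simp: H_def)
      finally have "(u j, x) \<in> (Restr (parcs T) H)\<^sup>*" .
      moreover have "(r, u j) \<in> Restr (parcs T) H" using 2 u inH by auto
      ultimately show ?thesis by (rule converse_rtrancl_into_rtrancl[rotated])
    qed simp
  qed
  have proper_A: "c' x \<noteq> c' y" if j: "j \<in> J" and xy: "x \<in> A j" "y \<in> A j" "(x, y) \<in> parcs T" for j x y
  proof -
    have yx: "(y, x) \<in> parcs T" using xy(3) by (rule arcs_symmetric)
    consider "x = u j" "y = u j" | "x = u j" "y \<in> B j" | "x \<in> B j" "y = u j" | "x \<in> B j" "y \<in> B j"
      using xy by (auto simp: A_def)
    then show ?thesis
      by cases (use j xy yx no_loops' u_nbr[OF j] c'u[OF j] c'B[OF j] proper in auto)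
  qed
  \<comment> \<open>Within \<open>H\<close>, the neighbors of \<open>r\<close> are vertices
    \<open>u j\<close>, and any other arc lies inside a single \<open>A j\<close>.\<close>
  have proper': "c' x \<noteq> c' y" if "(x, y) \<in> parcs ?G" for x y
  proof -
    have xy: "(x, y) \<in> parcs T" "(y, x) \<in> parcs T" "x \<in> H" "y \<in> H"
      using that arcs_symmetric by auto
    have r_case: "c' z \<noteq> s" if "z \<in> H" "(r, z) \<in> parcs T" for z
    proof -
      have "z \<noteq> r" using that no_loops' by blast
      then obtain j where "j \<in> J" "z \<in> A j" using \<open>z \<in> H\<close> by (auto simp: H_def)
      then have "j \<in> J" "z = u j" using r_nbr that by auto
      then show ?thesis using c'u by (auto simp: J_def)
    qed
    show ?thesis
    proof (cases "x = r \<or> y = r")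
      case True
      then show ?thesis using r_case xy c'r by metis
    next
      case False
      then obtain i j where ij: "i \<in> J" "x \<in> A i" "j \<in> J" "y \<in> A j" using xy by (auto simp: H_def)
      then have "i = j" using separate xy(1) by blast
      then show ?thesis using proper_A ij xy(1) by blast
    qed
  qed
  have J_s: "{1..s} = insert s J" using s by (auto simp: J_def)
  have "c' ` H = {1..s}"
  proof
    show "c' ` H \<subseteq> {1..s}"
    proof
      fix i assume "i \<in> c' ` H"
      then obtain x where "x \<in> H" "i = c' x" by blast
      from H_cases[OF \<open>x \<in> H\<close>] have "c' x \<in> {1..s}"
      proof (elim disjE bexE)
        fix j assume "j \<in> J" "x \<in> B j"
        then show ?thesis using c'B B(3,4)[of j x] by simp
      qed (use c'r c'u s in \<open>auto simp: J_def\<close>)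
      with \<open>i = c' x\<close> show "i \<in> {1..s}" by simp
    qed
    show "{1..s} \<subseteq> c' ` H"
      unfolding J_s using c'r c'u inH by (metis image_eqI insert_subset subsetI)
  qed
  with proper' have "proper_coloring ?G s c'"
    unfolding proper_coloring_def induced_simps by blast
  have nbr_r: "(r, u i) \<in> parcs ?G \<and> c' (u i) = i" if "i \<in> J" for i
    using that u inH c'u by simp
  have nbr_u_r: "(u j, r) \<in> parcs ?G \<and> c' r = s" if "j \<in> J" for j
    using that u inH c'r arcs_symmetric by simp
  \<comment> \<open>The original color of \<open>u j\<close> exceeds \<open>i\<close>, so the Grundy
    property gives a neighbor of color \<open>i\<close>, which belongs to \<open>W j\<close>. This
    covers also \<open>i > j\<close>, as domination requires.\<close>
  have nbr_u: "\<exists>w. (u j, w) \<in> parcs ?G \<and> c' w = i" if j: "j \<in> J" and i: "i \<in> J" "i \<noteq> j" for i j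
  proof -
    have "i < c (u j)" "1 \<le> i" using cu[OF j] i j by (auto simp: J_def)
    then obtain w where w: "(u j, w) \<in> parcs T" "c w = i" using down[OF uV[OF j]] by blast
    then have "w \<in> B j" using i by (auto simp: B_def W_def)
    then show ?thesis using w inH j c'B by auto
  qed
  \<comment> \<open>\<open>B j\<close> is closed under \<open>R\<close>, so the smaller-colored
    neighbors that the Grundy property of \<open>c\<close> provides all survive in
    \<open>H\<close>.\<close>
  have nbr_B: "\<exists>w. (d, w) \<in> parcs ?G \<and> c' w = i"
    if j: "j \<in> J" and d: "d \<in> B j" and i: "1 \<le> i" "i < c' d" for i j d
  proof -
    have "i < c d" using i c'B[OF j d] by simp
    then obtain w where w: "(d, w) \<in> parcs T" "c w = i" using down[OF B(1)[OF j d] i(1)] by blast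
    then have "(d, w) \<in> R" using \<open>i < c d\<close> by (simp add: R_def)
    then have "w \<in> B j" using d by (auto simp: B_def intro: rtrancl_into_rtrancl)
    then show ?thesis using w inH d j c'B by auto
  qed
  have "\<exists>w. (x, w) \<in> parcs ?G \<and> c' w = i" if i: "i \<in> {1..s}" "i < c' x" and x: "x \<in> H" for i x
    using H_cases[OF x]
  proof (elim disjE bexE)
    assume "x = r"
    then show ?thesis using i c'r nbr_r[of i] by (auto simp: J_def)
  next
    fix j assume "j \<in> J" "x = u j"
    then show ?thesis using i c'u nbr_u[of j i] by (auto simp: J_def)
  next
    fix j assume "j \<in> J" "x \<in> B j"
    then show ?thesis using nbr_B i by simp
  qed
  with \<open>proper_coloring ?G s c'\<close> have grundy: "grundy_coloring ?G s c'"
    unfolding grundy_coloring_def by simp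
  have cd_r: "color_dominating ?G s c' r"
    unfolding color_dominating_def J_s using inH(1) nbr_r c'r
    by (metis induced_simps(1) insertE)
  have cd_u: "color_dominating ?G s c' (u j)" if "j \<in> J" for j
    unfolding color_dominating_def J_s using that inH(2) nbr_u nbr_u_r c'u
    by (metis induced_simps(1) insertE)
  define v where "v j = (if j = s then r else u j)" for j
  have v: "c' (v j) = j \<and> color_dominating ?G s c' (v j)" if "j \<in> {1..s}" for j
  proof -
    from that consider "j = s" | "j \<in> J" unfolding J_s by blast
    then show ?thesis
      by cases (use cd_r cd_u c'r c'u in \<open>auto simp: v_def J_def\<close>)
  qed
  have "(v s, v j) \<in> parcs ?G" if "j \<in> {1..s}" "j \<noteq> s" for j
  proof -
    have "j \<in> J" using that unfolding J_s by blast
    with that nbr_r show ?thesis by (simp add: v_def)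
  qed
  then have "z_coloring ?G s c'"
    unfolding z_coloring_def using grundy v by blast
  then show ?thesis
    using z_coloring_extend[OF connH _ _ s(1)] inH(1) unfolding s_def by blast
qed

section \<open>Small cases and the numerical bound\<close>

lemma one_coloring_z_coloring:
  assumes "grundy_coloring T 1 c"
  shows "z_coloring T 1 c"
proof -
  have im: "c ` pverts T = {1}"
    using assms by (simp add: grundy_coloring_def proper_coloring_def)
  then obtain v where "v \<in> pverts T" "c v = 1" by blast
  then have "color_dominating T 1 c v" by (simp add: color_dominating_def)
  with \<open>c v = 1\<close> assms show ?thesis
    unfolding z_coloring_def by (intro conjI exI[of _ "\<lambda>_. v"]) auto
qed

text \<open>The two ends of an arc carry a z-coloring with colors 1 and 2, which then extends to
  \<open>T\<close>.\<close>

lemma ex_z_coloring_two_colors: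
  assumes "(x, y) \<in> parcs T"
  shows "\<exists>c. z_coloring T 2 c"
proof -
  have yx: "(y, x) \<in> parcs T" "x \<noteq> y" using assms arcs_symmetric no_loops' by blast+
  have two: "{1..2} = {1, 2 :: nat}" by auto
  define c where "c z = (if z = x then 1 else 2 :: nat)" for z
  let ?G = "induced T {x, y}"
  have "c ` {x, y} = {1, 2}" using yx by (auto simp: c_def)
  moreover have "c a \<noteq> c b" if "(a, b) \<in> parcs ?G" for a b
    using that yx no_loops' by (auto simp: c_def)
  ultimately have proper: "proper_coloring ?G 2 c"
    unfolding proper_coloring_def two by auto
  have arcs: "(x, y) \<in> parcs ?G" "(y, x) \<in> parcs ?G" and c: "c x = 1" "c y = 2"
    using assms yx by (auto simp: c_def)
  have grundy: "grundy_coloring ?G 2 c"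
    unfolding grundy_coloring_def two using proper arcs c by auto
  have cd: "color_dominating ?G 2 c x" "color_dominating ?G 2 c y"
    unfolding color_dominating_def two using arcs c by auto
  define u where "u j = (if j = 1 then x else y)" for j :: nat
  have "z_coloring ?G 2 c"
    unfolding z_coloring_def two
    by (intro conjI grundy exI[of _ u]) (use cd arcs c in \<open>auto simp: u_def\<close>)
  moreover have "connected_in T {x, y}"
    using connected_in_insert[OF connected_in_singleton, of y y x] yx(1)
    by (auto dest: in_arcsD1)
  ultimately show ?thesis by (intro z_coloring_extend) auto
qed

text \<open>Ensures that the maximum defining \<open>grundy_number\<close> is attained.\<close>

lemma ex_grundy_coloring: "\<exists>k c. grundy_coloring T k c"
proof (cases "parcs T = {}")
  case True
  have "pverts T \<noteq> {}"
    using utree by (auto simp: undirected_tree_def connected_def strongly_connected_def)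
  then have "grundy_coloring T 1 (\<lambda>_. 1)"
    using True by (auto simp: grundy_coloring_def proper_coloring_def)
  then show ?thesis by blast
next
  case False
  then obtain x y where "(x, y) \<in> parcs T" by auto
  then obtain c where "z_coloring T 2 c" using ex_z_coloring_two_colors by blast
  then show ?thesis unfolding z_coloring_def by blast
qed

lemma le_z_number: "z_coloring T k c \<Longrightarrow> k \<le> z_number T"
  unfolding z_number_def using finite_z_coloring_sizes[OF pair_finite_verts] by (auto intro: Max_ge)

lemma grundy_number_le: "grundy_number T \<le> 2 * z_number T - 1"
proof -
  let ?k = "grundy_number T"
  have "{k. \<exists>c. grundy_coloring T k c} \<noteq> {}" using ex_grundy_coloring by blast
  from Max_in[OF finite_grundy_coloring_sizes[OF pair_finite_verts] this]
  obtain c where c: "grundy_coloring T ?k c" unfolding grundy_number_def by blast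
  consider "?k = 0" | "?k = 1" | "?k \<ge> 2" by linarith
  then show ?thesis
  proof cases
    case 2
    then show ?thesis using one_coloring_z_coloring le_z_number c by fastforce
  next
    case 3
    then obtain c' where "z_coloring T (?k div 2 + 1) c'"
      using z_coloring_of_grundy_coloring[OF c] by blast
    \<comment> \<open>\<open>k div 2 + 1 \<le> z\<close> gives \<open>k \<le> 2 * z - 1\<close> for
      either parity of \<open>k\<close>.\<close>
    from le_z_number[OF this] show ?thesis by linarith
  qed simp
qed

end

theorem theorem4:
  fixes T :: "'a pair_pre_digraph"
  assumes "undirected_tree T"
  shows "grundy_number T \<le> (z_number T)\<^sup>2"
proof -
  interpret utree T by unfold_locales fact
  \<comment> \<open>For positive \<open>z\<close> this is \<open>(z - 1)\<^sup>2 \<ge> 0\<close>;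
    for \<open>z = 0\<close> the truncated difference is 0.\<close>
  have "(2 :: nat) * z - 1 \<le> z\<^sup>2" for z
  proof (cases z)
    case (Suc n)
    then show ?thesis by (simp add: power2_eq_square)
  qed simp
  with grundy_number_le show ?thesis by (rule order_trans)
qed

end
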